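(* Let ${\rm A}={\rm NS}$ or ${\rm R}$. In terms of the generating functions $K^\pm(z)=\sum_{\pm m\ge0}K^\pm_mz^{-m}$, $T(z)=\sum_{m\in\mathbb Z}T_mz^{-m}$, $G^\pm(z)=\sum_{m\in\mathbb Z^{\rm A}}G^\pm_mz^{-m}$, $K(z)=K^-(z)K^+(z)$ and $W(z)=\sum_{m\in\mathbb Z}W_mz^{-m}$, the defining mode relations (R2)--(R11) of $\mathcal{SV}ir_{q,k}$ listed in the context are equivalent, respectively, to the following relations (rational factors are read as Taylor series in the domain $|z|\ll|w|$): $$K^\pm(z)K^\pm(w)=K^\pm(w)K^\pm(z),\tag{2}$$ $$K^-(z)K^+(w)=\frac{(1-q^{2k+2}z/w)(1-q^{-2k-2}z/w)}{(1-q^2z/w)(1-q^{-2}z/w)}K^+(w)K^-(z),\tag{3}$$ $$K^-(z)T(w)=\frac{(1-q^{k+1}z/w)(1-q^{-k-1}z/w)}{(1-q^{k+3}z/w)(1-q^{-k-3}z/w)}T(w)K^-(z),\tag{4}$$ $$T(z)K^+(w)=\frac{(1-q^{k+1}z/w)(1-q^{-k-1}z/w)}{(1-q^{k+3}z/w)(1-q^{-k-3}z/w)}K^+(w)T(z),\tag{5}$$ $$K^-(z)G^\pm(w)=q^{\pm(k+2)}\frac{1-z/w}{1-q^{\pm2(k+2)}z/w}G^\pm(w)K^-(z),\tag{6}$$ $$G^\pm(z)K^+(w)=q^{\mp(k+2)}\frac{1-z/w}{1-q^{\mp2(k+2)}z/w}K^+(w)G^\pm(z),\tag{7}$$ $$G^\pm(z)G^\pm(w)+G^\pm(w)G^\pm(z)=0,\tag{8}$$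 $$G^+(z)G^-(w)+G^-(w)G^+(z)=\frac1{(q-q^{-1})^2}\Bigl(\delta^{\rm A}\bigl(q^{4(k+1)}\tfrac wz\bigr)\tfrac1{[k+1]}K(q^{2(k+1)}w)-\delta^{\rm A}\bigl(q^{2(k+2)}\tfrac wz\bigr)+\delta^{\rm A}\bigl(q^{2(k+1)}\tfrac wz\bigr)T(q^{k+1}w)\Bigr),\tag{9}$$ $$G^\pm(z)T(w)-T(w)G^\pm(z)=\pm(q-q^{-1})\frac{[k+2]}{[k+1]}\delta^{\rm A}\bigl(q^{\pm3(k+1)}\tfrac wz\bigr)K^-(q^{\pm(k+1)}w)G^\pm(q^{\pm(k+1)}w)K^+(q^{\pm(k+1)}w),\tag{10}$$ $$T(z)T(w)-T(w)T(z)=(q-q^{-1})\frac{[k+2]^2}{[k+1]}\Bigl(\delta\bigl(q^{2(k+1)}\tfrac wz\bigr)K^-(q^{k+1}w)W(q^{k+1}w)K^+(q^{k+1}w)-\delta\bigl(q^{-2(k+1)}\tfrac wz\bigr)K^-(q^{-k-1}w)W(q^{-k-1}w)K^+(q^{-k-1}w)\Bigr).\tag{11}$$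
   Context: Conventions. $q,k$ are generic complex numbers with $|q|\le1$, $|q^k|\le1$; $k\ne-2$, $q$ not a root of unity. $[u]=(q^u-q^{-u})/(q-q^{-1})$. $\mathbb Z^{\rm R}=\mathbb Z$, $\mathbb Z^{\rm NS}=\mathbb Z+\frac12$, $\delta^{\rm A}(z)=\sum_{m\in\mathbb Z^{\rm A}}z^m$, $\delta=\delta^{\rm R}$. Infinite sums are understood formally. The algebra $\mathcal{SV}ir_{q,k}$ in the sector A is the unital associative algebra generated by $K^\pm_m$ ($\pm m\ge0$), $T_m$ ($m\in\mathbb Z$), $G^\pm_m$ ($m\in\mathbb Z^{\rm A}$), with the convention $K^\pm_m=0$ for $\mp m>0$, with relations: (R1) $K_0^+=K_0^-$, and $K_0^\pm$ are invertible; (R2) $K^\pm_mK^\pm_n=K^\pm_nK^\pm_m$; (R3) $K^-_mK^+_n=K^+_nK^-_m-(q-q^{-1})^2\sum_{\ell=1}^{-m}\frac{[k][k+2][2\ell]}{[2]}K^+_{n-\ell}K^-_{m+\ell}$; (R4) $K^-_mT_n=T_nK^-_m+(q-q^{-1})^2\sum_{\ell=1}^{-m}\frac{[k+2][(k+3)\ell]}{[k+3]}T_{n-\ell}K^-_{m+\ell}$; (R5) $T_mK^+_n=K^+_nT_m+(q-q^{-1})^2\sum_{\ell=1}^{n}\frac{[k+2][(k+3)\ell]}{[k+3]}K^+_{n-\ell}T_{m+\ell}$; (R6) $K^-_mG^\pm_n=q^{\pm(k+2)}G^\pm_nK^-_m\pm(q-q^{-1})[k+2]\sum_{\ell=1}^{-m}q^{\pm2(k+2)\ell}G^\pm_{n-\ell}K^-_{m+\ell}$;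 (R7) $G^\pm_mK^+_n=q^{\mp(k+2)}K^+_nG^\pm_m\mp(q-q^{-1})[k+2]\sum_{\ell=1}^{n}q^{\mp2(k+2)\ell}K^+_{n-\ell}G^\pm_{m+\ell}$; (R8) $G^\pm_mG^\pm_n+G^\pm_nG^\pm_m=0$; (R9) $G^+_mG^-_n+G^-_nG^+_m=\frac1{(q-q^{-1})^2}\bigl(\frac1{[k+1]}q^{(2k+2)(m-n)}\sum_{\alpha,\beta\ge0}\delta_{m+n+\alpha-\beta,0}K^-_{-\alpha}K^+_\beta-q^{(k+2)(m-n)}\delta_{m+n,0}+q^{(k+1)(m-n)}T_{m+n}\bigr)$; (R10) $G^\pm_mT_n-T_nG^\pm_m=\pm(q-q^{-1})\frac{[k+2]}{[k+1]}q^{\pm(k+1)(2m-n)}\sum_{\alpha,\beta\ge0}K^-_{-\alpha}G^\pm_{m+n+\alpha-\beta}K^+_\beta$; (R11) $T_mT_n-T_nT_m=(q-q^{-1})^2\frac{[k+2]^2}{[k+1]}[(m-n)(k+1)]\sum_{\alpha,\beta\ge0}K^-_{-\alpha}W_{m+n+\alpha-\beta}K^+_\beta$. Here $W_m=\sum_{\mu,\nu\ge0}c^{\rm A}_m(2k+2)\delta_{m+\mu-\nu,0}\frac1{[k+1]}K^-_{-\mu}K^+_\nu-c^{\rm A}_m(k+2)\delta_{m,0}+c^{\rm A}_m(k+1)T_m-(q-q^{-1})^3\sum_{\gamma\in\mathbb Z^{\rm A}}N(G^+_{-\gamma}G^-_{m+\gamma})$, with $c^{\rm NS}_\alpha(u)=\frac1{[u]}$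 ($\alpha$ even), $\frac1{[u]}\frac{q^u+q^{-u}}2$ ($\alpha$ odd); $c^{\rm R}_\alpha(u)=\frac1{[u]}\frac{q^u+q^{-u}}2$ ($\alpha$ even), $\frac1{[u]}$ ($\alpha$ odd); and $N(G^+_mG^-_n)=G^+_mG^-_n$ if $m<n$, $\frac12(G^+_mG^-_m-G^-_mG^+_m)$ if $m=n$, $-G^-_nG^+_m$ if $m>n$. *)

theory Defs
  imports "HOL-Analysis.Analysis" "HOL-Library.Function_Algebras"
    "HOL-Computational_Algebra.Formal_Power_Series"
begin

text \<open>
  The relations are stated for families of elements of an arbitrary unital associative complex
  algebra. A formal infinite sum is an unconditional sum (\<open>infsum\<close>) in a Hausdorff topology
  compatible with the vector space structure. This covers completions of the free algebra on the
  generators and of its quotients, and also operators on a restricted module, with the topology of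
  pointwise stabilization, where the sums are locally finite. A relation containing an infinite
  sum includes the assertion that the sum exists, so the default value \<open>0\<close> of \<open>infsum\<close> plays
  no role.
\<close>

locale complex_algebra = vector_space scale
  for scale :: "complex \<Rightarrow> 'a \<Rightarrow> 'a::{ring_1, topological_ab_group_add, t2_space}" +
  assumes scale_mult_left: "scale c (x * y) = scale c x * y"
    and scale_mult_right: "scale c (x * y) = x * scale c y"
    and continuous_scale: "continuous_on UNIV (scale c)"

datatype sector = NS | R

datatype sign = Plus | Minus

fun sg :: "sign \<Rightarrow> complex" where
  "sg Plus = 1"
| "sg Minus = -1"

text \<open>
  All mode indices are real numbers, so that integer and half-integer modes can be mixed; families
  are extended by zero outside their index sets.
\<close>

fun ZZ :: "sector \<Rightarrow> real set" where
  "ZZ R = \<int>"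
| "ZZ NS = {m. m - 1/2 \<in> \<int>}"

definition even_mode :: "real \<Rightarrow> bool" where
  "even_mode m \<longleftrightarrow> (\<exists>j::int. m = 2 * of_int j)"

definition kdelta :: "real \<Rightarrow> complex" where
  "kdelta m = (if m = 0 then 1 else 0)"

text \<open>
  Powers of \<open>q\<close> with complex exponents depend on a choice of logarithm \<open>h\<close> of \<open>q\<close>.
\<close>

definition qpow :: "complex \<Rightarrow> complex \<Rightarrow> complex" where
  "qpow h u = exp (h * u)"

definition qnum :: "complex \<Rightarrow> complex \<Rightarrow> complex" where
  "qnum h u = (qpow h u - qpow h (-u)) / (qpow h 1 - qpow h (-1))"

text \<open>
  Besides the standing conditions, genericity means that the \<open>q\<close>-numbers occurring as
  denominators in the relations do not vanish (the remaining one, \<open>[2]\<close>, is nonzero because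
  \<open>q\<close> is not a root of unity).
\<close>

definition generic_parameters :: "complex \<Rightarrow> complex \<Rightarrow> complex \<Rightarrow> bool" where
  "generic_parameters q h k \<longleftrightarrow>
     q = exp h \<and> cmod q \<le> 1 \<and> cmod (qpow h k) \<le> 1 \<and> k \<noteq> -2 \<and>
     (\<forall>n::nat. n > 0 \<longrightarrow> q ^ n \<noteq> 1) \<and>
     qnum h (k+1) \<noteq> 0 \<and> qnum h (k+2) \<noteq> 0 \<and> qnum h (k+3) \<noteq> 0 \<and> qnum h (2*k+2) \<noteq> 0"

definition mode_families ::
  "sector \<Rightarrow> (sign \<Rightarrow> real \<Rightarrow> 'a::zero) \<Rightarrow> (real \<Rightarrow> 'a) \<Rightarrow> (sign \<Rightarrow> real \<Rightarrow> 'a) \<Rightarrow> bool" where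
  "mode_families A K T G \<longleftrightarrow>
     (\<forall>m. \<not> (m \<in> \<int> \<and> m \<ge> 0) \<longrightarrow> K Plus m = 0) \<and>
     (\<forall>m. \<not> (m \<in> \<int> \<and> m \<le> 0) \<longrightarrow> K Minus m = 0) \<and>
     (\<forall>m. m \<notin> \<int> \<longrightarrow> T m = 0) \<and>
     (\<forall>s m. m \<notin> ZZ A \<longrightarrow> G s m = 0)"

fun cc :: "complex \<Rightarrow> sector \<Rightarrow> real \<Rightarrow> complex \<Rightarrow> complex" where
  "cc h NS m u = (if even_mode m then 1 / qnum h u
                  else 1 / qnum h u * ((qpow h u + qpow h (-u)) / 2))"
| "cc h R m u = (if even_mode m then 1 / qnum h u * ((qpow h u + qpow h (-u)) / 2)
                 else 1 / qnum h u)"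


section \<open>Formal distributions\<close>

text \<open>
  A series in one variable is given by the coefficients \<open>X m\<close> of \<open>z\<^sup>-\<^sup>m\<close>, a series in \<open>z, w\<close> by the
  coefficients \<open>X m n\<close> of \<open>z\<^sup>-\<^sup>m w\<^sup>-\<^sup>n\<close>. Addition, subtraction and zero of
  series are pointwise; the pointwise product of functions is not used.
\<close>

type_synonym 'a fd1 = "real \<Rightarrow> 'a"
type_synonym 'a fd2 = "real \<Rightarrow> real \<Rightarrow> 'a"

definition in_z :: "'a::zero fd1 \<Rightarrow> 'a fd2" where
  "in_z X = (\<lambda>m n. if n = 0 then X m else 0)"

definition in_w :: "'a::zero fd1 \<Rightarrow> 'a fd2" where
  "in_w X = (\<lambda>m n. if m = 0 then X n else 0)"

definition fd_mult :: "'a::{ring_1, topological_ab_group_add, t2_space} fd2 \<Rightarrow> 'a fd2 \<Rightarrow> 'a fd2"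
    (infixl \<open>\<star>\<close> 70) where
  "X \<star> Y = (\<lambda>m n. \<Sum>\<^sub>\<infinity>(a, b)\<in>UNIV. X a b * Y (m - a) (n - b))"

text \<open>
  Products of series in the same variable. In \<open>mult3\<close> the sum runs over all index triples
  simultaneously, so that no bracketing is involved.
\<close>

definition mult2 :: "'a::{ring_1, topological_ab_group_add, t2_space} fd1 \<Rightarrow> 'a fd1 \<Rightarrow> 'a fd1" where
  "mult2 X Y = (\<lambda>p. \<Sum>\<^sub>\<infinity>a\<in>UNIV. X a * Y (p - a))"

definition mult2_defined ::
  "'a::{ring_1, topological_ab_group_add, t2_space} fd1 \<Rightarrow> 'a fd1 \<Rightarrow> bool" where
  "mult2_defined X Y \<longleftrightarrow> (\<forall>p. (\<lambda>a. X a * Y (p - a)) summable_on UNIV)"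

definition mult3 ::
  "'a::{ring_1, topological_ab_group_add, t2_space} fd1 \<Rightarrow> 'a fd1 \<Rightarrow> 'a fd1 \<Rightarrow> 'a fd1" where
  "mult3 X Y Z = (\<lambda>p. \<Sum>\<^sub>\<infinity>(a, b)\<in>UNIV. X a * Y b * Z (p - a - b))"

definition mult3_defined ::
  "'a::{ring_1, topological_ab_group_add, t2_space} fd1 \<Rightarrow> 'a fd1 \<Rightarrow> 'a fd1 \<Rightarrow> bool" where
  "mult3_defined X Y Z \<longleftrightarrow> (\<forall>p. (\<lambda>(a, b). X a * Y b * Z (p - a - b)) summable_on UNIV)"


section \<open>The defining mode relations and the current relations\<close>

context
  fixes h k :: complex
    and A :: sector
    and scale :: "complex \<Rightarrow> 'a \<Rightarrow> 'a::{ring_1, topological_ab_group_add, t2_space}"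
      (infixr \<open>\<cdot>\<close> 75)
    and K :: "sign \<Rightarrow> real \<Rightarrow> 'a"
    and T :: "real \<Rightarrow> 'a"
    and G :: "sign \<Rightarrow> real \<Rightarrow> 'a"
begin

definition qd :: complex where
  "qd = qpow h 1 - qpow h (-1)"

definition N :: "real \<Rightarrow> real \<Rightarrow> 'a" where
  "N m n = (if m < n then G Plus m * G Minus n
            else if m = n then (1/2) \<cdot> (G Plus m * G Minus m - G Minus m * G Plus m)
            else - (G Minus n * G Plus m))"

definition W :: "real \<Rightarrow> 'a" where
  "W m = (if m \<in> \<int> then
       (\<Sum>\<^sub>\<infinity>(\<mu>, \<nu>)\<in>(UNIV :: (nat \<times> nat) set).
          (cc h A m (2*k+2) * kdelta (m + real \<mu> - real \<nu>) * (1 / qnum h (k+1))) \<cdot> (K Minus (- real \<mu>) * K Plus (real \<nu>)))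
       - (cc h A m (k+2) * kdelta m) \<cdot> 1
       + cc h A m (k+1) \<cdot> T m
       - qd ^ 3 \<cdot> (\<Sum>\<^sub>\<infinity>\<gamma>\<in>ZZ A. N (-\<gamma>) (m + \<gamma>))
     else 0)"

definition W_defined :: bool where
  "W_defined \<longleftrightarrow> (\<forall>m\<in>\<int>.
       (\<lambda>(\<mu>, \<nu>). (cc h A m (2*k+2) * kdelta (m + real \<mu> - real \<nu>) * (1 / qnum h (k+1)))
                   \<cdot> (K Minus (- real \<mu>) * K Plus (real \<nu>))) summable_on (UNIV :: (nat \<times> nat) set) \<and>
       (\<lambda>\<gamma>. N (-\<gamma>) (m + \<gamma>)) summable_on ZZ A)"


subsection \<open>Mode relations\<close>

definition mode_R2 :: bool where
  "mode_R2 \<longleftrightarrow> (\<forall>s. \<forall>m n :: int. K s m * K s n = K s n * K s m)"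

definition mode_R3 :: bool where
  "mode_R3 \<longleftrightarrow> (\<forall>m n :: int.
     K Minus m * K Plus n =
     K Plus n * K Minus m
     - qd\<^sup>2 \<cdot> (\<Sum>l\<in>{1..-m}. (qnum h k * qnum h (k+2) * qnum h (2 * of_int l) / qnum h 2)
                              \<cdot> (K Plus (n - l) * K Minus (m + l))))"

definition mode_R4 :: bool where
  "mode_R4 \<longleftrightarrow> (\<forall>m n :: int.
     K Minus m * T n =
     T n * K Minus m
     + qd\<^sup>2 \<cdot> (\<Sum>l\<in>{1..-m}. (qnum h (k+2) * qnum h ((k+3) * of_int l) / qnum h (k+3))
                              \<cdot> (T (n - l) * K Minus (m + l))))"

definition mode_R5 :: bool where
  "mode_R5 \<longleftrightarrow> (\<forall>m n :: int.
     T m * K Plus n =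
     K Plus n * T m
     + qd\<^sup>2 \<cdot> (\<Sum>l\<in>{1..n}. (qnum h (k+2) * qnum h ((k+3) * of_int l) / qnum h (k+3))
                              \<cdot> (K Plus (n - l) * T (m + l))))"

definition mode_R6 :: bool where
  "mode_R6 \<longleftrightarrow> (\<forall>s. \<forall>m :: int. \<forall>n\<in>ZZ A.
     K Minus m * G s n =
     qpow h (sg s * (k+2)) \<cdot> (G s n * K Minus m)
     + (sg s * qd * qnum h (k+2)) \<cdot>
         (\<Sum>l\<in>{1..-m}. qpow h (sg s * 2 * (k+2) * of_int l) \<cdot> (G s (n - l) * K Minus (m + l))))"

definition mode_R7 :: bool where
  "mode_R7 \<longleftrightarrow> (\<forall>s. \<forall>m\<in>ZZ A. \<forall>n :: int.
     G s m * K Plus n =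
     qpow h (- sg s * (k+2)) \<cdot> (K Plus n * G s m)
     - (sg s * qd * qnum h (k+2)) \<cdot>
         (\<Sum>l\<in>{1..n}. qpow h (- sg s * 2 * (k+2) * of_int l) \<cdot> (K Plus (n - l) * G s (m + l))))"

definition mode_R8 :: bool where
  "mode_R8 \<longleftrightarrow> (\<forall>s. \<forall>m\<in>ZZ A. \<forall>n\<in>ZZ A. G s m * G s n + G s n * G s m = 0)"

definition mode_R9 :: bool where
  "mode_R9 \<longleftrightarrow> (\<forall>m\<in>ZZ A. \<forall>n\<in>ZZ A.
     (\<lambda>(\<alpha>, \<beta>). kdelta (m + n + real \<alpha> - real \<beta>) \<cdot> (K Minus (- real \<alpha>) * K Plus (real \<beta>)))
        summable_on (UNIV :: (nat \<times> nat) set) \<and>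
     G Plus m * G Minus n + G Minus n * G Plus m =
     (1 / qd\<^sup>2) \<cdot>
       ((1 / qnum h (k+1) * qpow h ((2*k+2) * of_real (m - n))) \<cdot>
           (\<Sum>\<^sub>\<infinity>(\<alpha>, \<beta>)\<in>(UNIV :: (nat \<times> nat) set).
              kdelta (m + n + real \<alpha> - real \<beta>) \<cdot> (K Minus (- real \<alpha>) * K Plus (real \<beta>)))
        - (qpow h ((k+2) * of_real (m - n)) * kdelta (m + n)) \<cdot> 1
        + qpow h ((k+1) * of_real (m - n)) \<cdot> T (m + n)))"

definition mode_R10 :: bool where
  "mode_R10 \<longleftrightarrow> (\<forall>s. \<forall>m\<in>ZZ A. \<forall>n :: int.
     (\<lambda>(\<alpha>, \<beta>). K Minus (- real \<alpha>) * G s (m + of_int n + real \<alpha> - real \<beta>) * K Plus (real \<beta>))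
        summable_on (UNIV :: (nat \<times> nat) set) \<and>
     G s m * T n - T n * G s m =
     (sg s * qd * (qnum h (k+2) / qnum h (k+1)) * qpow h (sg s * (k+1) * of_real (2*m - of_int n))) \<cdot>
       (\<Sum>\<^sub>\<infinity>(\<alpha>, \<beta>)\<in>(UNIV :: (nat \<times> nat) set).
          K Minus (- real \<alpha>) * G s (m + of_int n + real \<alpha> - real \<beta>) * K Plus (real \<beta>)))"

definition mode_R11 :: bool where
  "mode_R11 \<longleftrightarrow> W_defined \<and> (\<forall>m n :: int.
     (\<lambda>(\<alpha>, \<beta>). K Minus (- real \<alpha>) * W (of_int (m + n) + real \<alpha> - real \<beta>) * K Plus (real \<beta>))
        summable_on (UNIV :: (nat \<times> nat) set) \<and>
     T m * T n - T n * T m =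
     (qd\<^sup>2 * ((qnum h (k+2))\<^sup>2 / qnum h (k+1)) * qnum h ((of_int m - of_int n) * (k+1))) \<cdot>
       (\<Sum>\<^sub>\<infinity>(\<alpha>, \<beta>)\<in>(UNIV :: (nat \<times> nat) set).
          K Minus (- real \<alpha>) * W (of_int (m + n) + real \<alpha> - real \<beta>) * K Plus (real \<beta>)))"


subsection \<open>Current relations\<close>

definition fd_scale :: "complex \<Rightarrow> 'a fd2 \<Rightarrow> 'a fd2" where
  "fd_scale c X = (\<lambda>m n. c \<cdot> X m n)"

text \<open>\<open>X(q\<^sup>u w)\<close> for a series \<open>X(w)\<close>.\<close>

definition dil :: "complex \<Rightarrow> 'a fd1 \<Rightarrow> 'a fd1" where
  "dil u X = (\<lambda>m. qpow h (- u * of_real m) \<cdot> X m)"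

text \<open>\<open>\<delta>\<^sup>B(q\<^sup>u w/z)\<close>. The exponent \<open>u\<close> is the argument because half-integer powers of \<open>q\<^sup>u\<close> occur.\<close>

definition delta :: "sector \<Rightarrow> complex \<Rightarrow> 'a fd2" where
  "delta B u = (\<lambda>m n. if m \<in> ZZ B \<and> n = -m then qpow h (u * of_real m) \<cdot> 1 else 0)"

text \<open>\<open>f(z/w)\<close> for a power series \<open>f\<close>; fractions of power series are Taylor expansions at \<open>0\<close>.\<close>

definition taylor :: "complex fps \<Rightarrow> 'a fd2" where
  "taylor f = (\<lambda>m n. if m \<in> \<int> \<and> m \<le> 0 \<and> n = -m then fps_nth f (nat \<lfloor>n\<rfloor>) \<cdot> 1 else 0)"

definition lin :: "complex \<Rightarrow> complex fps" where
  "lin u = 1 - fps_const (qpow h u) * fps_X"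

definition current_2 :: bool where
  "current_2 \<longleftrightarrow> (\<forall>s. in_z (K s) \<star> in_w (K s) = in_w (K s) \<star> in_z (K s))"

definition current_3 :: bool where
  "current_3 \<longleftrightarrow>
     in_z (K Minus) \<star> in_w (K Plus) =
     taylor ((lin (2*k+2) * lin (-2*k-2)) / (lin 2 * lin (-2))) \<star> (in_w (K Plus) \<star> in_z (K Minus))"

definition current_4 :: bool where
  "current_4 \<longleftrightarrow>
     in_z (K Minus) \<star> in_w T =
     taylor ((lin (k+1) * lin (-k-1)) / (lin (k+3) * lin (-k-3))) \<star> (in_w T \<star> in_z (K Minus))"

definition current_5 :: bool where
  "current_5 \<longleftrightarrow>
     in_z T \<star> in_w (K Plus) =
     taylor ((lin (k+1) * lin (-k-1)) / (lin (k+3) * lin (-k-3))) \<star> (in_w (K Plus) \<star> in_z T)"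

definition current_6 :: bool where
  "current_6 \<longleftrightarrow> (\<forall>s.
     in_z (K Minus) \<star> in_w (G s) =
     fd_scale (qpow h (sg s * (k+2)))
       (taylor (lin 0 / lin (sg s * 2 * (k+2))) \<star> (in_w (G s) \<star> in_z (K Minus))))"

definition current_7 :: bool where
  "current_7 \<longleftrightarrow> (\<forall>s.
     in_z (G s) \<star> in_w (K Plus) =
     fd_scale (qpow h (- sg s * (k+2)))
       (taylor (lin 0 / lin (- sg s * 2 * (k+2))) \<star> (in_w (K Plus) \<star> in_z (G s))))"

definition current_8 :: bool where
  "current_8 \<longleftrightarrow> (\<forall>s. in_z (G s) \<star> in_w (G s) + in_w (G s) \<star> in_z (G s) = 0)"

definition current_9 :: bool where
  "current_9 \<longleftrightarrow> mult2_defined (K Minus) (K Plus) \<and>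
     in_z (G Plus) \<star> in_w (G Minus) + in_w (G Minus) \<star> in_z (G Plus) =
     fd_scale (1 / qd\<^sup>2)
       (fd_scale (1 / qnum h (k+1))
          (delta A (4*(k+1)) \<star> in_w (dil (2*(k+1)) (mult2 (K Minus) (K Plus))))
        - delta A (2*(k+2))
        + delta A (2*(k+1)) \<star> in_w (dil (k+1) T))"

definition current_10 :: bool where
  "current_10 \<longleftrightarrow> (\<forall>s. let u = sg s * (k+1) in
     mult3_defined (dil u (K Minus)) (dil u (G s)) (dil u (K Plus)) \<and>
     in_z (G s) \<star> in_w T - in_w T \<star> in_z (G s) =
     fd_scale (sg s * qd * (qnum h (k+2) / qnum h (k+1)))
       (delta A (sg s * 3 * (k+1)) \<star>
          in_w (mult3 (dil u (K Minus)) (dil u (G s)) (dil u (K Plus)))))"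

definition current_11 :: bool where
  "current_11 \<longleftrightarrow> W_defined \<and> (let u = k + 1; v = - k - 1 in
     mult3_defined (dil u (K Minus)) (dil u W) (dil u (K Plus)) \<and>
     mult3_defined (dil v (K Minus)) (dil v W) (dil v (K Plus)) \<and>
     in_z T \<star> in_w T - in_w T \<star> in_z T =
     fd_scale (qd * ((qnum h (k+2))\<^sup>2 / qnum h (k+1)))
       (delta R (2*(k+1)) \<star> in_w (mult3 (dil u (K Minus)) (dil u W) (dil u (K Plus)))
        - delta R (-2*(k+1)) \<star> in_w (mult3 (dil v (K Minus)) (dil v W) (dil v (K Plus)))))"

end

end

theory Submission
  imports Defs
begin

text \<open>
  Compare the coefficients of \<open>z\<^sup>-\<^sup>m w\<^sup>-\<^sup>n\<close>. In the relations (3)--(7) one family is supported on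
  a half-line, so each coefficient of the product with the Taylor series is a finite sum, and the
  mode relation is read off from the partial fraction expansion of the rational factor. In (9)--(11)
  the coefficient of \<open>\<delta>\<^sup>A(q\<^sup>u w/z) Y(w)\<close> is \<open>q\<^sup>u\<^sup>m Y\<^sub>m\<^sub>+\<^sub>n\<close>, and the dilations scale all
  terms of a product of modes of total degree \<open>p\<close> by the same power of \<open>q\<close>; since scaling by a
  nonzero number is a homeomorphism, this power can be taken out of the sum, and summability does
  not depend on it.
\<close>

section \<open>Unconditional sums and index sets\<close>

lemma has_sum_eq_imp_summable_on_eq:
  assumes "\<And>s. (f has_sum s) A \<longleftrightarrow> (g has_sum s) B"
  shows "f summable_on A \<longleftrightarrow> g summable_on B"
  using assms by (simp add: summable_on_def)

text \<open>Comparing the families through every candidate sum \<open>s\<close> transfers existence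
  and value at once. If no sum exists on one side, none exists on the other, and both values are the
  default \<open>0\<close>.\<close>

lemma has_sum_eq_imp_infsum_eq:
  fixes f :: "'a \<Rightarrow> 'c::{comm_monoid_add, t2_space}" and g :: "'b \<Rightarrow> 'c"
  assumes "\<And>s. (f has_sum s) A \<longleftrightarrow> (g has_sum s) B"
  shows "infsum f A = infsum g B"
proof (cases "f summable_on A")
  case True
  then show ?thesis using assms by (metis infsumI has_sum_infsum)
next
  case False
  then show ?thesis
    using has_sum_eq_imp_summable_on_eq[OF assms] by (simp add: infsum_not_exists)
qed

lemma infsum_eq_sum_neutral:
  fixes f :: "'a \<Rightarrow> 'b::{comm_monoid_add, t2_space}"
  assumes "finite S" "\<And>x. x \<notin> S \<Longrightarrow> f x = 0"
  shows "infsum f UNIV = sum f S"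
proof -
  have "infsum f UNIV = infsum f S"
    by (rule infsum_cong_neutral) (use assms in auto)
  then show ?thesis using assms by simp
qed

lemma ZZ_add_int:
  assumes "j \<in> \<int>"
  shows "m + j \<in> ZZ A \<longleftrightarrow> m \<in> ZZ A"
proof -
  have "x + j \<in> \<int> \<longleftrightarrow> x \<in> \<int>" for x :: real
    using assms by (metis Ints_add Ints_diff add_diff_cancel_right')
  from this[of m] this[of "m - 1/2"] show ?thesis
    by (cases A) (simp_all add: algebra_simps)
qed

lemma ZZ_add: "m \<in> ZZ A \<Longrightarrow> n \<in> ZZ A \<Longrightarrow> m + n \<in> \<int>"
proof (cases A)
  case NS
  assume "m \<in> ZZ A" "n \<in> ZZ A"
  then have "(m - 1/2) + (n - 1/2) + 1 \<in> \<int>" using NS by (intro Ints_add) auto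
  then show ?thesis by simp
qed auto

lemma ZZ_add_imp:
  assumes "m \<in> ZZ A" "m + n \<in> \<int>"
  shows "n \<in> ZZ A"
proof (cases A)
  case NS
  then have "(m + n) - (m - 1/2) - 1 \<in> \<int>"
    using assms by (intro Ints_diff[OF Ints_diff Ints_1]) simp_all
  then show ?thesis using NS by (simp add: algebra_simps)
next
  case R
  then have "(m + n) - m \<in> \<int>" using assms by (intro Ints_diff) auto
  then show ?thesis using R by simp
qed

lemma ZZ_nonempty: "\<exists>m. m \<in> ZZ A"
  by (cases A) (auto intro: exI[of _ "1/2"] exI[of _ 0])

section \<open>Coefficients of products of currents in different variables\<close>

text \<open>Of all index pairs in the convolution only \<open>(m, 0)\<close> can contribute, so the
  sum is finite. In \<open>in_w_in_z\<close> it is the pair \<open>(0, n)\<close>, and the order of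
  the noncommuting factors is kept.\<close>

lemma in_z_in_w: "(in_z X \<star> in_w Y) m n = X m * Y n"
proof -
  have "(in_z X \<star> in_w Y) m n = (\<Sum>(a, b)\<in>{(m, 0)}. in_z X a b * in_w Y (m - a) (n - b))"
    unfolding fd_mult_def by (rule infsum_eq_sum_neutral) (auto simp: in_z_def in_w_def split: if_splits)
  then show ?thesis by (simp add: in_z_def in_w_def)
qed

lemma in_w_in_z: "(in_w Y \<star> in_z X) m n = Y n * X m"
proof -
  have "(in_w Y \<star> in_z X) m n = (\<Sum>(a, b)\<in>{(0, n)}. in_w Y a b * in_z X (m - a) (n - b))"
    unfolding fd_mult_def by (rule infsum_eq_sum_neutral) (auto simp: in_z_def in_w_def split: if_splits)
  then show ?thesis by (simp add: in_z_def in_w_def)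
qed

section \<open>Powers of q and Taylor coefficients of the rational factors\<close>

lemma qpow_add: "qpow h (u + v) = qpow h u * qpow h v"
  by (simp add: qpow_def distrib_left exp_add)

lemma qpow_nonzero [simp]: "qpow h u \<noteq> 0"
  by (simp add: qpow_def)

lemma qpow_0 [simp]: "qpow h 0 = 1"
  by (simp add: qpow_def)

lemma qpow_power: "qpow h u ^ l = qpow h (u * of_nat l)"
  by (simp add: qpow_def exp_of_nat_mult[symmetric] mult_ac)

lemma lin_nonzero: "lin h u \<noteq> 0"
proof
  assume "lin h u = 0"
  then have "fps_nth (lin h u) 0 = 0" by simp
  then show False by (simp add: lin_def)
qed

text \<open>Numerator and denominator both have constant and quadratic coefficient 1, so they differ
  by a multiple of x. With B = q^b and B' = q^(-b), partial fractions turn the ratio into 1 + c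
  (1/(1 - B x) - 1/(1 - B' x)). The hypothesis on \<open>b\<close> keeps the two poles
  apart.\<close>

lemma fps_nth_lin_ratio2:
  assumes "qpow h b \<noteq> qpow h (- b)" "l > 0"
  shows "fps_nth ((lin h a * lin h (- a)) / (lin h b * lin h (- b))) l =
     (qpow h b + qpow h (- b) - qpow h a - qpow h (- a)) *
     ((qpow h (b * of_nat l) - qpow h (- (b * of_nat l))) / (qpow h b - qpow h (- b)))"
proof -
  define B B' c where "B = qpow h b" "B' = qpow h (- b)"
    "c = (qpow h b + qpow h (- b) - qpow h a - qpow h (- a)) / (qpow h b - qpow h (- b))"
  \<comment> \<open>The candidate expansion. It is checked by multiplying back with the denominator,
    which is cancelled at the end. The value at 0 is exceptional, since the formula for positive
    degrees would give 0 there.\<close>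
  define g where "g = Abs_fps (\<lambda>l. if l = 0 then 1 else c * (B ^ l - B' ^ l))"
  have inv: "B * B' = 1"
    by (simp add: B_B'_c_def flip: qpow_add)
  have c: "c * (B - B') = B + B' - qpow h a - qpow h (- a)"
    using assms by (simp add: B_B'_c_def)
  have lin_prod: "lin h u * lin h (- u) = 1 - fps_const (qpow h u + qpow h (- u)) * fps_X + fps_X ^ 2" for u
  proof -
    have "lin h u * lin h (- u) = 1 - fps_const (qpow h u + qpow h (- u)) * fps_X
        + fps_const (qpow h u * qpow h (- u)) * fps_X ^ 2"
      by (simp add: lin_def algebra_simps power2_eq_square flip: fps_const_mult fps_const_add)
    then show ?thesis by (simp flip: qpow_add)
  qed
  have "g * (lin h b * lin h (- b)) = lin h a * lin h (- a)"
  proof (rule fps_ext)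
    fix n
    have eq: "g * (lin h b * lin h (- b)) = g - fps_const (B + B') * (fps_X * g) + fps_X ^ 2 * g"
      unfolding lin_prod B_B'_c_def(1,2) by (simp add: algebra_simps)
    \<comment> \<open>The denominator has degree 2, so coefficient \<open>n\<close> involves
      \<open>g\<close> at \<open>n\<close>, \<open>n - 1\<close> and \<open>n - 2\<close>. The
      exceptional value of \<open>g\<close> at 0 is felt only for \<open>n \<le> 2\<close>; beyond
      that a homogeneous recurrence with characteristic roots \<open>B\<close> and \<open>B'\<close>
      remains.\<close>
    consider "n = 0" | "n = 1" | "n = 2" | j where "n = Suc (Suc (Suc j))"
      by (metis One_nat_def numeral_2_eq_2 old.nat.exhaust)
    then show "fps_nth (g * (lin h b * lin h (- b))) n = fps_nth (lin h a * lin h (- a)) n"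
    proof cases
      case 2
      then show ?thesis unfolding eq unfolding lin_prod using c
        by (simp add: g_def fps_X_power_mult_nth algebra_simps)
    next
      case 3
      then have "fps_nth (g * (lin h b * lin h (- b))) n
          = c * (B^2 - B'^2) - (B + B') * (c * (B - B')) + 1"
        unfolding eq by (simp add: g_def fps_X_power_mult_nth)
      also have "\<dots> = 1"
        by (simp add: algebra_simps power2_eq_square)
      finally show ?thesis
        unfolding lin_prod using 3 by simp
    next
      case 4
      have "c * (B ^ Suc (Suc (Suc j)) - B' ^ Suc (Suc (Suc j)))
          - (B + B') * (c * (B ^ Suc (Suc j) - B' ^ Suc (Suc j))) + c * (B ^ Suc j - B' ^ Suc j)
        = c * (B * B' - 1) * (B' ^ Suc j - B ^ Suc j)"
        by (simp add: algebra_simps)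
      then show ?thesis unfolding eq unfolding lin_prod using 4 inv
        by (simp add: g_def fps_X_power_mult_nth)
    next
      case 1
      then show ?thesis unfolding eq unfolding lin_prod
        by (simp add: g_def fps_X_power_mult_nth)
    qed
  qed
  then have "(lin h a * lin h (- a)) / (lin h b * lin h (- b)) = g"
    by (metis lin_nonzero mult_eq_0_iff nonzero_mult_div_cancel_right)
  then show ?thesis using assms(2)
    by (simp add: g_def B_B'_c_def qpow_power)
qed

lemma fps_nth_lin_ratio2_0:
  "fps_nth ((lin h a * lin h a') / (lin h b * lin h b')) 0 = 1"
  by (subst fps_divide_unit) (simp_all add: lin_def)

lemma fps_nth_lin_ratio_0: "fps_nth (lin h a / lin h b) 0 = 1"
  by (subst fps_divide_unit) (simp_all add: lin_def)

text \<open>The ratio is the geometric series of 1/(1 - B x) minus its shift by x, with B = q^b;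
  this gives B^l - B^(l-1) in positive degree. The shift has no constant term, hence the separate
  value at 0.\<close>

lemma fps_nth_lin_ratio:
  assumes "l > 0"
  shows "fps_nth (lin h 0 / lin h b) l = qpow h (b * of_nat l) * (1 - qpow h (- b))"
proof -
  define B B' where "B = qpow h b" "B' = qpow h (- b)"
  define g where "g = Abs_fps (\<lambda>l. if l = 0 then 1 else B ^ l * (1 - B'))"
  have inv: "B * B' = 1"
    by (simp add: B_B'_def flip: qpow_add)
  have "g * lin h b = lin h 0"
  proof (rule fps_ext)
    fix n
    have eq: "g * lin h b = g - fps_const B * (fps_X * g)"
      unfolding lin_def B_B'_def(1,2) by (simp add: algebra_simps)
    consider "n = 0" | "n = 1" | j where "n = Suc (Suc j)"
      by (metis One_nat_def old.nat.exhaust)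
    then show "fps_nth (g * lin h b) n = fps_nth (lin h 0) n"
      unfolding eq by cases (use inv in \<open>simp_all add: lin_def g_def algebra_simps\<close>)
  qed
  then have "lin h 0 / lin h b = g"
    by (metis lin_nonzero nonzero_mult_div_cancel_right)
  then show ?thesis using assms
    by (simp add: g_def B_B'_def qpow_power)
qed

section \<open>Sums over pairs of natural numbers as products of series\<close>

text \<open>A pair \<open>(\<alpha>, \<beta>)\<close> from the mode relations corresponds to left
  mode \<open>a\<close>, middle mode \<open>b\<close> and right mode \<open>p - a - b\<close>. The
  image consists of the pairs at which the half-line supports of both outer families are
  met.\<close>

lemma minus_plus_nat_image:
  "(\<lambda>(\<alpha>, \<beta>). (- real \<alpha>, p + real \<alpha> - real \<beta>)) ` UNIV
    = {(a, b). (a \<in> \<int> \<and> a \<le> 0) \<and> (p - a - b \<in> \<int> \<and> p - a - b \<ge> 0)}"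
    (is "?f ` UNIV = ?S")
proof
  show "?S \<subseteq> ?f ` UNIV"
  proof clarify
    fix a b
    assume *: "a \<in> \<int>" "a \<le> 0" "p - a - b \<in> \<int>" "p - a - b \<ge> 0"
    then have "- a \<in> \<nat>" "p - a - b \<in> \<nat>" by (auto simp: Nats_altdef2)
    then obtain i j where "- a = real i" "p - a - b = real j" by (auto elim!: Nats_cases)
    then have "(a, b) = ?f (i, j)" by auto
    then show "(a, b) \<in> ?f ` UNIV" by blast
  qed
qed auto

text \<open>Injective reindexing, followed by extending the range by index pairs at which an outer
  factor vanishes. No support condition falls on the middle family, so \<open>G\<close> and
  \<open>W\<close> can both be inserted.\<close>

lemma has_sum_triple_nat_iff:
  fixes X Y Z :: "real \<Rightarrow> 'b::{ring_1, topological_ab_group_add, t2_space}"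
  assumes X: "\<And>m. \<not> (m \<in> \<int> \<and> m \<le> 0) \<Longrightarrow> X m = 0"
    and Z: "\<And>m. \<not> (m \<in> \<int> \<and> m \<ge> 0) \<Longrightarrow> Z m = 0"
  shows "((\<lambda>(\<alpha>, \<beta>). X (- real \<alpha>) * Y (p + real \<alpha> - real \<beta>) * Z (real \<beta>)) has_sum s) UNIV
    \<longleftrightarrow> ((\<lambda>(a, b). X a * Y b * Z (p - a - b)) has_sum s) UNIV"
proof -
  let ?f = "\<lambda>(\<alpha>, \<beta>). (- real \<alpha>, p + real \<alpha> - real \<beta>)"
  let ?g = "\<lambda>(a, b). X a * Y b * Z (p - a - b)"
  have "(\<lambda>(\<alpha>, \<beta>). X (- real \<alpha>) * Y (p + real \<alpha> - real \<beta>) * Z (real \<beta>)) = ?g \<circ> ?f"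
    by (auto simp: fun_eq_iff)
  moreover have "inj ?f" by (auto simp: inj_def)
  moreover have "(?g has_sum s) (range ?f) \<longleftrightarrow> (?g has_sum s) UNIV"
    unfolding minus_plus_nat_image
  proof (rule has_sum_cong_neutral)
    fix x
    assume x: "x \<in> UNIV - {(a, b). (a \<in> \<int> \<and> a \<le> 0) \<and> (p - a - b \<in> \<int> \<and> p - a - b \<ge> 0)}"
    obtain a b where ab: "x = (a, b)" by fastforce
    with x consider "\<not> (a \<in> \<int> \<and> a \<le> 0)" | "\<not> (p - a - b \<in> \<int> \<and> p - a - b \<ge> 0)" by auto
    then show "?g x = 0"
      by cases (auto simp: ab X Z)
  qed auto
  ultimately show ?thesis by (simp add: has_sum_reindex)
qed

text \<open>The case of three factors with the constant series 1 in the middle: its only mode, at 0,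
  encodes the Kronecker delta.\<close>

lemma has_sum_pair_nat_iff:
  fixes X Z :: "real \<Rightarrow> 'b::{ring_1, topological_ab_group_add, t2_space}"
  assumes X: "\<And>m. \<not> (m \<in> \<int> \<and> m \<le> 0) \<Longrightarrow> X m = 0"
    and Z: "\<And>m. \<not> (m \<in> \<int> \<and> m \<ge> 0) \<Longrightarrow> Z m = 0"
  shows "((\<lambda>(\<alpha>, \<beta>). if p + real \<alpha> - real \<beta> = 0 then X (- real \<alpha>) * Z (real \<beta>) else 0) has_sum s) UNIV
    \<longleftrightarrow> ((\<lambda>a. X a * Z (p - a)) has_sum s) UNIV"
proof -
  define Y :: "real \<Rightarrow> 'b" where "Y = (\<lambda>m. if m = 0 then 1 else 0)"
  have "(\<lambda>(\<alpha>, \<beta>). if p + real \<alpha> - real \<beta> = 0 then X (- real \<alpha>) * Z (real \<beta>) else 0)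
      = (\<lambda>(\<alpha>, \<beta>). X (- real \<alpha>) * Y (p + real \<alpha> - real \<beta>) * Z (real \<beta>))"
    by (auto simp: fun_eq_iff Y_def)
  moreover have "((\<lambda>(a, b). X a * Y b * Z (p - a - b)) has_sum s) UNIV
      \<longleftrightarrow> ((\<lambda>(a, b). X a * Y b * Z (p - a - b)) has_sum s) (range (\<lambda>a. (a, 0)))"
    by (rule has_sum_cong_neutral) (auto simp: Y_def)
  moreover have "\<dots> \<longleftrightarrow> ((\<lambda>a. X a * Z (p - a)) has_sum s) UNIV"
    by (subst has_sum_reindex) (auto simp: inj_def o_def Y_def)
  ultimately show ?thesis using has_sum_triple_nat_iff[where X = X and Y = Y and Z = Z, OF X Z] by simp
qed

section \<open>Scalar multiplication and infinite sums\<close>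

context complex_algebra
begin

lemma has_sum_scale:
  assumes "(f has_sum s) S"
  shows "((\<lambda>x. scale c (f x)) has_sum scale c s) S"
proof -
  have "scale c \<midarrow>s\<rightarrow> scale c s"
    using continuous_scale by (simp add: continuous_on_def)
  then have "((scale c \<circ> f) has_sum scale c s) S"
    using assms by (intro has_sum_comm_additive_general) (simp_all add: scale_sum_right)
  then show ?thesis by (simp add: o_def)
qed

lemma summable_on_scale_iff:
  assumes "c \<noteq> 0"
  shows "(\<lambda>x. scale c (f x)) summable_on S \<longleftrightarrow> f summable_on S"
proof
  assume "(\<lambda>x. scale c (f x)) summable_on S"
  then obtain s where "((\<lambda>x. scale c (f x)) has_sum s) S" by (auto simp: summable_on_def)
  from has_sum_scale[OF this, of "inverse c"] show "f summable_on S"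
    using assms by (auto simp: summable_on_def)
qed (auto simp: summable_on_def dest: has_sum_scale)

text \<open>Without summability both sides are the default \<open>0\<close>;
  \<open>c \<noteq> 0\<close> ensures that the two families fail to be summable together.\<close>

lemma infsum_scale:
  assumes "c \<noteq> 0"
  shows "infsum (\<lambda>x. scale c (f x)) S = scale c (infsum f S)"
proof (cases "f summable_on S")
  case True
  then show ?thesis by (intro infsumI has_sum_scale has_sum_infsum)
next
  case False
  then show ?thesis using assms by (simp add: infsum_not_exists summable_on_scale_iff)
qed

lemma scale_1_mult: "scale c 1 * x = scale c x"
  by (metis mult_1 scale_mult_left)

section \<open>Multiplication by delta distributions and Taylor series\<close>

lemma delta_in_w:
  "(delta h scale B u \<star> in_w Y) m n =
    (if m \<in> ZZ B then scale (qpow h (u * of_real m)) (Y (m + n)) else 0)"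
proof -
  have "(delta h scale B u \<star> in_w Y) m n
      = (\<Sum>(a, b)\<in>{(m, - m)}. delta h scale B u a b * in_w Y (m - a) (n - b))"
    unfolding fd_mult_def
    by (rule infsum_eq_sum_neutral) (auto simp: delta_def in_w_def split: if_splits)
  then show ?thesis by (simp add: delta_def in_w_def scale_1_mult add.commute)
qed

text \<open>The term of degree \<open>l\<close> in z/w sits at the index pair
  \<open>(- l, l)\<close>, so it shifts the modes of \<open>F\<close> by \<open>l\<close> in
  opposite directions. The bound \<open>L\<close> makes the sum finite and need not be
  sharp.\<close>

lemma taylor_mult:
  assumes "\<And>l. l > L \<Longrightarrow> F (m + real l) (n - real l) = 0"
  shows "(taylor scale f \<star> F) m n
    = (\<Sum>l\<le>L. scale (fps_nth f l) (F (m + real l) (n - real l)))"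
proof -
  have "(taylor scale f \<star> F) m n
      = (\<Sum>(a, b)\<in>(\<lambda>l. (- real l, real l)) ` {..L}. taylor scale f a b * F (m - a) (n - b))"
    unfolding fd_mult_def
  proof (rule infsum_eq_sum_neutral)
    fix x
    assume x: "x \<notin> (\<lambda>l. (- real l, real l)) ` {..L}"
    obtain a b where ab: "x = (a, b)" by fastforce
    show "(case x of (a, b) \<Rightarrow> taylor scale f a b * F (m - a) (n - b)) = 0"
    proof (cases "a \<in> \<int> \<and> a \<le> 0 \<and> b = - a")
      case True
      then obtain l where "a = - real l"
        by (metis Ints_cases neg_le_0_iff_le nonneg_int_cases of_int_0_le_iff of_int_of_nat_eq
            of_int_minus minus_minus)
      then show ?thesis using x ab True assms[of l] by (cases "l \<le> L") auto
    qed (auto simp: ab taylor_def)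
  qed simp
  also have "\<dots> = (\<Sum>l\<le>L. scale (fps_nth f l) (F (m + real l) (n - real l)))"
    by (subst sum.reindex) (auto simp: inj_on_def taylor_def scale_1_mult)
  finally show ?thesis .
qed

text \<open>Brings the finite sum into the shape of the mode relations: the term of degree 0 is
  split off, the remaining degrees are indexed by integers, and the prefactor \<open>c\<close> is
  moved into the coefficients.\<close>

lemma taylor_mult_int:
  assumes "fps_nth f 0 = 1" "M \<ge> 0"
    and "\<And>l. l > nat M \<Longrightarrow> F (m + real l) (n - real l) = 0"
  shows "scale c ((taylor scale f \<star> F) m n)
    = scale c (F m n)
      + (\<Sum>l\<in>{1..M}. scale (c * fps_nth f (nat l)) (F (m + of_int l) (n - of_int l)))"
proof -
  have "{..nat M} = insert 0 (nat ` {1..M})"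
  proof -
    have "x \<in> nat ` {1..M}" if "x \<le> nat M" "x \<noteq> 0" for x
      by (rule image_eqI[of _ _ "int x"]) (use that assms(2) in auto)
    then show ?thesis using assms(2) by fastforce
  qed
  moreover have "inj_on nat {1..M}" by (auto simp: inj_on_def)
  moreover have "0 \<notin> nat ` {1..M}" by auto
  ultimately have "(taylor scale f \<star> F) m n
      = F m n + (\<Sum>l\<in>{1..M}. scale (fps_nth f (nat l)) (F (m + real (nat l)) (n - real (nat l))))"
    using assms by (subst taylor_mult[where L = "nat M" and F = F and m = m and n = n, OF assms(3)])
      (simp_all add: sum.reindex)
  also have "(\<Sum>l\<in>{1..M}. scale (fps_nth f (nat l)) (F (m + real (nat l)) (n - real (nat l))))
      = (\<Sum>l\<in>{1..M}. scale (fps_nth f (nat l)) (F (m + of_int l) (n - of_int l)))"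
    by (rule sum.cong) auto
  finally show ?thesis by (simp add: scale_right_distrib scale_sum_right)
qed

section \<open>Exchange relations with a rational factor\<close>

text \<open>Common form of \<open>current_3\<close>, \<open>current_4\<close> and
  \<open>current_6\<close>. The support of \<open>X\<close> truncates the Taylor sum at
  \<open>l = - m\<close>, because \<open>X (m + l)\<close> vanishes beyond. \<open>c\<close> is the
  constant in front of the rational factor; \<open>e\<close> and \<open>d\<close> split its
  coefficients as the mode relations do.\<close>

lemma exchange_relation_nonpos:
  assumes X: "\<And>m. \<not> (m \<in> \<int> \<and> m \<le> 0) \<Longrightarrow> X m = 0"
    and Y: "\<And>n. n \<notin> ZZ B \<Longrightarrow> Y n = 0"
    and f: "fps_nth f 0 = 1" "\<And>l. l \<ge> 1 \<Longrightarrow> c * fps_nth f (nat l) = e * d l"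
  shows "in_z X \<star> in_w Y = fd_scale scale c (taylor scale f \<star> (in_w Y \<star> in_z X)) \<longleftrightarrow>
    (\<forall>m::int. \<forall>n\<in>ZZ B. X m * Y n = scale c (Y n * X m)
      + scale e (\<Sum>l\<in>{1..-m}. scale (d l) (Y (n - l) * X (m + l))))"
    (is "?L \<longleftrightarrow> _")
proof -
  let ?F = "in_w Y \<star> in_z X"
  let ?rhs = "\<lambda>(m::int) (n::real). scale c (Y n * X m)
      + scale e (\<Sum>l\<in>{1..-m}. scale (d l) (Y (n - l) * X (m + l)))"
  have rhs: "scale c ((taylor scale f \<star> ?F) (of_int m) n) = ?rhs m n" if "m \<le> 0" for m :: int and n
    using that f X by (subst taylor_mult_int[where M = "- m"]) (auto simp: in_w_in_z scale_sum_right)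
  \<comment> \<open>The current relation also has coefficients outside the index sets of the mode
    relation. Shifting by \<open>l\<close> keeps such indices outside the supports, so there every
    term is zero.\<close>
  have trivial: "X m * Y n = scale c ((taylor scale f \<star> ?F) m n)"
    if "\<not> (m \<in> \<int> \<and> m \<le> 0 \<and> n \<in> ZZ B)" for m n
  proof -
    have zero: "Y (n - real l) * X (m + real l) = 0" for l
    proof (cases "n \<in> ZZ B")
      case True
      with that have "\<not> (m + real l \<in> \<int> \<and> m + real l \<le> 0)"
        using ZZ_add_int[of "real l" m R] by auto
      then show ?thesis using X by simp
    next
      case False
      then show ?thesis using Y ZZ_add_int[of "- real l" n B] by simp
    qed
    moreover have "Y n * X m = 0" using zero[of 0] by simp
    moreover have "X m * Y n = 0" using that X Y by (cases "n \<in> ZZ B") auto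
    ultimately show ?thesis by (subst taylor_mult[where L = 0]) (simp_all add: in_w_in_z)
  qed
  have "?L \<longleftrightarrow> (\<forall>m n. X m * Y n = scale c ((taylor scale f \<star> ?F) m n))"
    by (simp add: fun_eq_iff fd_scale_def in_z_in_w)
  also have "\<dots> \<longleftrightarrow> (\<forall>m::int. \<forall>n\<in>ZZ B. X m * Y n = ?rhs m n)"
  proof (intro iffI allI ballI)
    fix m :: int and n
    assume "\<forall>m n. X m * Y n = scale c ((taylor scale f \<star> ?F) m n)"
    \<comment> \<open>For \<open>m > 0\<close> the mode relation reads 0 = 0: \<open>X m\<close>
      vanishes and the range \<open>{1..-m}\<close> is empty.\<close>
    then show "X m * Y n = ?rhs m n"
      using X[of m] rhs[of m n] by (cases "m \<le> 0") auto
  next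
    fix m n
    assume *: "\<forall>m::int. \<forall>n\<in>ZZ B. X m * Y n = ?rhs m n"
    show "X m * Y n = scale c ((taylor scale f \<star> ?F) m n)"
    proof (cases "m \<in> \<int> \<and> m \<le> 0 \<and> n \<in> ZZ B")
      case True
      then obtain m' where "m = of_int m'" by (auto elim: Ints_cases)
      then show ?thesis using * True rhs[of m' n] by simp
    qed (rule trivial)
  qed
  finally show ?thesis .
qed

text \<open>Mirror image for \<open>current_5\<close> and \<open>current_7\<close>: now the second
  family truncates, since \<open>Y (n - l)\<close> vanishes for \<open>l > n\<close>.\<close>

lemma exchange_relation_nonneg:
  assumes X: "\<And>m. m \<notin> ZZ B \<Longrightarrow> X m = 0"
    and Y: "\<And>n. \<not> (n \<in> \<int> \<and> n \<ge> 0) \<Longrightarrow> Y n = 0"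
    and f: "fps_nth f 0 = 1" "\<And>l. l \<ge> 1 \<Longrightarrow> c * fps_nth f (nat l) = e * d l"
  shows "in_z X \<star> in_w Y = fd_scale scale c (taylor scale f \<star> (in_w Y \<star> in_z X)) \<longleftrightarrow>
    (\<forall>m\<in>ZZ B. \<forall>n::int. X m * Y n = scale c (Y n * X m)
      + scale e (\<Sum>l\<in>{1..n}. scale (d l) (Y (n - l) * X (m + l))))"
    (is "?L \<longleftrightarrow> _")
proof -
  let ?F = "in_w Y \<star> in_z X"
  let ?rhs = "\<lambda>(m::real) (n::int). scale c (Y n * X m)
      + scale e (\<Sum>l\<in>{1..n}. scale (d l) (Y (n - l) * X (m + l)))"
  have rhs: "scale c ((taylor scale f \<star> ?F) m (of_int n)) = ?rhs m n" if "n \<ge> 0" for n :: int and m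
    using that f Y by (subst taylor_mult_int[where M = n]) (auto simp: in_w_in_z scale_sum_right)
  have trivial: "X m * Y n = scale c ((taylor scale f \<star> ?F) m n)"
    if "\<not> (m \<in> ZZ B \<and> n \<in> \<int> \<and> n \<ge> 0)" for m n
  proof -
    have zero: "Y (n - real l) * X (m + real l) = 0" for l
    proof (cases "m \<in> ZZ B")
      case True
      with that have "\<not> (n - real l \<in> \<int> \<and> n - real l \<ge> 0)"
        using ZZ_add_int[of "- real l" n R] by auto
      then show ?thesis using Y by simp
    next
      case False
      then show ?thesis using X ZZ_add_int[of "real l" m B] by simp
    qed
    moreover have "Y n * X m = 0" using zero[of 0] by simp
    moreover have "X m * Y n = 0" using that X Y by (cases "m \<in> ZZ B") auto
    ultimately show ?thesis by (subst taylor_mult[where L = 0]) (simp_all add: in_w_in_z)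
  qed
  have "?L \<longleftrightarrow> (\<forall>m n. X m * Y n = scale c ((taylor scale f \<star> ?F) m n))"
    by (simp add: fun_eq_iff fd_scale_def in_z_in_w)
  also have "\<dots> \<longleftrightarrow> (\<forall>m\<in>ZZ B. \<forall>n::int. X m * Y n = ?rhs m n)"
  proof (intro iffI allI ballI)
    fix m and n :: int
    assume "\<forall>m n. X m * Y n = scale c ((taylor scale f \<star> ?F) m n)"
    then show "X m * Y n = ?rhs m n"
      using Y[of n] rhs[of n m] by (cases "n \<ge> 0") auto
  next
    fix m n
    assume *: "\<forall>m\<in>ZZ B. \<forall>n::int. X m * Y n = ?rhs m n"
    show "X m * Y n = scale c ((taylor scale f \<star> ?F) m n)"
    proof (cases "m \<in> ZZ B \<and> n \<in> \<int> \<and> n \<ge> 0")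
      case True
      then obtain n' where "n = of_int n'" by (auto elim: Ints_cases)
      then show ?thesis using * True rhs[of n' m] by simp
    qed (rule trivial)
  qed
  finally show ?thesis .
qed


section \<open>Dilated triple products\<close>

lemma dil_triple:
  "(\<lambda>(a, b). dil h scale u X a * dil h scale u Y b * dil h scale u Z (p - a - b))
    = (\<lambda>x. scale (qpow h (- u * of_real p)) (case x of (a, b) \<Rightarrow> X a * Y b * Z (p - a - b)))"
proof -
  have "qpow h (- u * of_real a) * qpow h (- u * of_real b) * qpow h (- u * of_real (p - a - b))
      = qpow h (- u * of_real p)" for a b
    by (simp add: algebra_simps flip: qpow_add)
  then show ?thesis
    by (auto simp: fun_eq_iff dil_def mult_ac simp flip: scale_mult_left scale_mult_right)
qed

lemma mult3_dil:
  "mult3 (dil h scale u X) (dil h scale u Y) (dil h scale u Z) p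
    = scale (qpow h (- u * of_real p)) (mult3 X Y Z p)"
  unfolding mult3_def dil_triple by (rule infsum_scale) simp

lemma mult3_defined_dil:
  "mult3_defined (dil h scale u X) (dil h scale u Y) (dil h scale u Z) \<longleftrightarrow> mult3_defined X Y Z"
  unfolding mult3_defined_def dil_triple by (simp add: summable_on_scale_iff)

section \<open>The equivalence for each relation\<close>

context
  fixes h k :: complex and A :: sector
    and K :: "sign \<Rightarrow> real \<Rightarrow> 'a" and T :: "real \<Rightarrow> 'a" and G :: "sign \<Rightarrow> real \<Rightarrow> 'a"
  assumes families: "mode_families A K T G"
begin

text \<open>The versions with \<open>ZZ R\<close> state integrality in the form in which the
  exchange lemmas expect it.\<close>

lemma K_Plus_0: "\<not> (m \<in> \<int> \<and> m \<ge> 0) \<Longrightarrow> K Plus m = 0"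
  and K_Minus_0: "\<not> (m \<in> \<int> \<and> m \<le> 0) \<Longrightarrow> K Minus m = 0"
  and K_0: "m \<notin> \<int> \<Longrightarrow> K s m = 0"
  and K_0_ZZ: "m \<notin> ZZ R \<Longrightarrow> K s m = 0"
  and T_0: "m \<notin> \<int> \<Longrightarrow> T m = 0"
  and T_0_ZZ: "m \<notin> ZZ R \<Longrightarrow> T m = 0"
  and G_0: "m \<notin> ZZ A \<Longrightarrow> G s m = 0"
  using families by (cases s; simp add: mode_families_def)+

lemma mode_R2_iff: "mode_R2 K \<longleftrightarrow> current_2 K"
proof
  assume *: "mode_R2 K"
  have "K s m * K s n = K s n * K s m" for s m n
  proof (cases "m \<in> \<int> \<and> n \<in> \<int>")
    case True
    then show ?thesis using * by (auto simp: mode_R2_def elim!: Ints_cases)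
  qed (use K_0 in auto)
  then show "current_2 K"
    by (simp add: current_2_def fun_eq_iff in_z_in_w in_w_in_z)
qed (simp add: mode_R2_def current_2_def fun_eq_iff in_z_in_w in_w_in_z)

lemma mode_R8_iff: "mode_R8 A G \<longleftrightarrow> current_8 G"
proof
  assume *: "mode_R8 A G"
  have "G s m * G s n + G s n * G s m = 0" for s m n
  proof (cases "m \<in> ZZ A \<and> n \<in> ZZ A")
    case True
    then show ?thesis using * by (auto simp: mode_R8_def)
  qed (use G_0 in auto)
  then show "current_8 G"
    by (simp add: current_8_def fun_eq_iff in_z_in_w in_w_in_z)
qed (simp add: mode_R8_def current_8_def fun_eq_iff in_z_in_w in_w_in_z)

lemma fd_scale_1: "fd_scale scale 1 X = X"
  by (simp add: fd_scale_def fun_eq_iff)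

lemma mode_R3_iff:
  assumes "qd h \<noteq> 0" "qpow h 2 \<noteq> qpow h (- 2)"
  shows "mode_R3 h k scale K \<longleftrightarrow> current_3 h k scale K"
proof -
  let ?f = "(lin h (2*k+2) * lin h (-2*k-2)) / (lin h 2 * lin h (-2))"
  have f: "1 * fps_nth ?f (nat l) = - (qd h)\<^sup>2 * (qnum h k * qnum h (k+2) * qnum h (2 * of_int l) / qnum h 2)"
    if "l \<ge> 1" for l :: int
  proof -
    \<comment> \<open>The numerator of the partial fraction constant factors because 2 and 2k+2 are
      the difference and the sum of k+2 and k; this produces the q-numbers [k] and [k+2].\<close>
    have "qpow h 2 + qpow h (- 2) - qpow h (2*k+2) - qpow h (- (2*k+2))
        = - (qpow h k - qpow h (- k)) * (qpow h (k+2) - qpow h (- (k+2)))"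
    proof -
      have "qpow h 2 = qpow h (- k) * qpow h (k+2)" "qpow h (- 2) = qpow h k * qpow h (- (k+2))"
        "qpow h (2*k+2) = qpow h k * qpow h (k+2)" "qpow h (- (2*k+2)) = qpow h (- k) * qpow h (- (k+2))"
        by (simp_all flip: qpow_add)
      then show ?thesis by (simp add: algebra_simps)
    qed
    also have "\<dots> = - (qd h)\<^sup>2 * (qnum h k * qnum h (k+2))"
      using assms(1) by (simp add: qnum_def qd_def power2_eq_square del: minus_diff_eq)
    finally have "qpow h 2 + qpow h (- 2) - qpow h (2*k+2) - qpow h (- (2*k+2))
        = - (qd h)\<^sup>2 * (qnum h k * qnum h (k+2))" .
    moreover have "- 2 * k - 2 = - (2 * k + 2)" by simp
    ultimately show ?thesis
      using fps_nth_lin_ratio2[of h 2 "nat l" "2*k+2"] that assms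
      by (simp add: qnum_def qd_def)
  qed
  show ?thesis
    unfolding current_3_def mode_R3_def
    using exchange_relation_nonpos[where X = "K Minus" and Y = "K Plus" and B = R and c = 1 and f = ?f
        and e = "- (qd h)\<^sup>2", OF K_Minus_0 K_0_ZZ fps_nth_lin_ratio2_0 f]
    by (simp add: fd_scale_1 fps_nth_lin_ratio2_0 Ints_def)
qed

text \<open>Serves \<open>mode_R4\<close> and \<open>mode_R5\<close>, whose rational factors agree.
  Here k+3 and k+1 are k+2 plus and minus 1, so one \<open>qd h\<close> comes from the exponent 1
  and the other from the denominator of [k+2].\<close>

lemma fps_nth_lin_ratio_R4:
  assumes "qd h \<noteq> 0" "qnum h (k+3) \<noteq> 0" "l \<ge> 1"
  shows "1 * fps_nth ((lin h (k+1) * lin h (-k-1)) / (lin h (k+3) * lin h (-k-3))) (nat l)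
    = (qd h)\<^sup>2 * (qnum h (k+2) * qnum h ((k+3) * of_int l) / qnum h (k+3))"
proof -
  have "qpow h (k+3) + qpow h (- (k+3)) - qpow h (k+1) - qpow h (- (k+1))
      = (qpow h 1 - qpow h (- 1)) * (qpow h (k+2) - qpow h (- (k+2)))"
    by (simp add: algebra_simps flip: qpow_add)
  also have "\<dots> = (qd h)\<^sup>2 * qnum h (k+2)"
    using assms(1) by (simp add: qnum_def qd_def power2_eq_square)
  finally show ?thesis
    using fps_nth_lin_ratio2[of h "k+3" "nat l" "k+1"] assms
    by (simp add: qnum_def qd_def)
qed

lemma mode_R4_iff:
  assumes "qd h \<noteq> 0" "qnum h (k+3) \<noteq> 0"
  shows "mode_R4 h k scale K T \<longleftrightarrow> current_4 h k scale K T"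
  unfolding current_4_def mode_R4_def
  using exchange_relation_nonpos[where X = "K Minus" and Y = T and B = R and c = 1,
      OF K_Minus_0 T_0_ZZ fps_nth_lin_ratio2_0 fps_nth_lin_ratio_R4[OF assms]]
  by (simp add: fd_scale_1 Ints_def)

lemma mode_R5_iff:
  assumes "qd h \<noteq> 0" "qnum h (k+3) \<noteq> 0"
  shows "mode_R5 h k scale K T \<longleftrightarrow> current_5 h k scale K T"
  unfolding current_5_def mode_R5_def
  using exchange_relation_nonneg[where X = T and Y = "K Plus" and B = R and c = 1,
      OF T_0_ZZ K_Plus_0 fps_nth_lin_ratio2_0 fps_nth_lin_ratio_R4[OF assms]]
  by (simp add: fd_scale_1 Ints_def)

text \<open>The prefactor symmetrizes 1 - q^(-2s(k+2)), with s the sign, into a difference of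
  opposite powers. That difference is odd in s, whence the factor \<open>sg s\<close>.\<close>

lemma fps_nth_lin_ratio_R6:
  assumes "qd h \<noteq> 0" "l \<ge> 1"
  shows "qpow h (sg s * (k+2)) * fps_nth (lin h 0 / lin h (sg s * 2 * (k+2))) (nat l)
    = sg s * qd h * qnum h (k+2) * qpow h (sg s * 2 * (k+2) * of_int l)"
proof -
  have "qpow h (sg s * (k+2)) * (1 - qpow h (- (sg s * 2 * (k+2))))
      = qpow h (sg s * (k+2)) - qpow h (- (sg s * (k+2)))"
    by (simp add: algebra_simps flip: qpow_add)
  also have "\<dots> = sg s * qd h * qnum h (k+2)"
    using assms(1) by (cases s) (simp_all add: qnum_def qd_def field_simps)
  finally show ?thesis
    using assms(2) by (simp add: fps_nth_lin_ratio)
qed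

lemma fps_nth_lin_ratio_R7:
  assumes "qd h \<noteq> 0" "l \<ge> 1"
  shows "qpow h (- sg s * (k+2)) * fps_nth (lin h 0 / lin h (- sg s * 2 * (k+2))) (nat l)
    = - (sg s * qd h * qnum h (k+2)) * qpow h (- sg s * 2 * (k+2) * of_int l)"
  \<comment> \<open>The factor for \<open>G\<close> to the left of \<open>K Plus\<close> is the
    previous one with the opposite sign.\<close>
  using fps_nth_lin_ratio_R6[OF assms, of "if s = Plus then Minus else Plus"]
  by (cases s) simp_all

lemma mode_R6_iff:
  assumes "qd h \<noteq> 0"
  shows "mode_R6 h k A scale K G \<longleftrightarrow> current_6 h k scale K G"
  unfolding current_6_def mode_R6_def
  using exchange_relation_nonpos[where X = "K Minus" and Y = "G s" and B = A for s,
      OF K_Minus_0 G_0 fps_nth_lin_ratio_0 fps_nth_lin_ratio_R6[OF assms]]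
  by simp

lemma mode_R7_iff:
  assumes "qd h \<noteq> 0"
  shows "mode_R7 h k A scale K G \<longleftrightarrow> current_7 h k scale K G"
  unfolding current_7_def mode_R7_def
  using exchange_relation_nonneg[where X = "G s" and Y = "K Plus" and B = A for s,
      OF G_0 K_Plus_0 fps_nth_lin_ratio_0 fps_nth_lin_ratio_R7[OF assms]]
  by simp

lemma mode_R9_iff: "mode_R9 h k A scale K T G \<longleftrightarrow> current_9 h k A scale K T G"
proof -
  let ?f = "\<lambda>p (\<alpha>, \<beta>). scale (kdelta (p + real \<alpha> - real \<beta>)) (K Minus (- real \<alpha>) * K Plus (real \<beta>))"
  let ?M = "mult2 (K Minus) (K Plus)"
  let ?L = "\<lambda>m n. G Plus m * G Minus n + G Minus n * G Plus m"
  let ?D = "in_z (G Plus) \<star> in_w (G Minus) + in_w (G Minus) \<star> in_z (G Plus)"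
  let ?C = "fd_scale scale (1 / (qd h)\<^sup>2)
       (fd_scale scale (1 / qnum h (k+1)) (delta h scale A (4*(k+1)) \<star> in_w (dil h scale (2*(k+1)) ?M))
        - delta h scale A (2*(k+2))
        + delta h scale A (2*(k+1)) \<star> in_w (dil h scale (k+1) T))"
  let ?R = "\<lambda>m n. scale (1 / (qd h)\<^sup>2)
       (scale (1 / qnum h (k+1) * qpow h ((2*k+2) * of_real (m - n))) (?M (m + n))
        - scale (qpow h ((k+2) * of_real (m - n)) * kdelta (m + n)) 1
        + scale (qpow h ((k+1) * of_real (m - n))) (T (m + n)))"
  have "?f p = (\<lambda>(\<alpha>, \<beta>). if p + real \<alpha> - real \<beta> = 0 then K Minus (- real \<alpha>) * K Plus (real \<beta>) else 0)" for p
    by (auto simp: kdelta_def fun_eq_iff)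
  then have has_sum: "(?f p has_sum s) UNIV \<longleftrightarrow> ((\<lambda>a. K Minus a * K Plus (p - a)) has_sum s) UNIV" for p s
    using has_sum_pair_nat_iff[where X = "K Minus" and Z = "K Plus", OF K_Minus_0 K_Plus_0] by simp
  have summable: "?f p summable_on UNIV \<longleftrightarrow> (\<lambda>a. K Minus a * K Plus (p - a)) summable_on UNIV" for p
    by (rule has_sum_eq_imp_summable_on_eq) (rule has_sum)
  have infsum: "infsum (?f p) UNIV = ?M p" for p
    unfolding mult2_def by (rule has_sum_eq_imp_infsum_eq) (rule has_sum)
  have nonint: "K Minus a * K Plus (p - a) = 0" if "p \<notin> \<int>" for a p
  proof (cases "a \<in> \<int>")
    case True
    then have "p - a \<notin> \<int>" using that by (metis Ints_add diff_add_cancel)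
    then show ?thesis by (simp add: K_0)
  qed (simp add: K_0)
  have M_0: "?M p = 0" if "p \<notin> \<int>" for p
    using nonint[OF that] by (simp add: mult2_def)
  \<comment> \<open>The sums \<open>m + n\<close> with both indices in \<open>ZZ A\<close> exhaust
    the integers, in either sector; at a noninteger \<open>p\<close> all terms vanish.\<close>
  have defined: "mult2_defined (K Minus) (K Plus) \<longleftrightarrow> (\<forall>m\<in>ZZ A. \<forall>n\<in>ZZ A. ?f (m + n) summable_on UNIV)"
    unfolding mult2_defined_def
  proof (intro iffI allI ballI)
    fix p
    assume *: "\<forall>m\<in>ZZ A. \<forall>n\<in>ZZ A. ?f (m + n) summable_on UNIV"
    show "(\<lambda>a. K Minus a * K Plus (p - a)) summable_on UNIV"
    proof (cases "p \<in> \<int>")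
      case True
      obtain m where m: "m \<in> ZZ A" using ZZ_nonempty by blast
      then have "p - m \<in> ZZ A" using True by (intro ZZ_add_imp[OF m]) simp
      then show ?thesis using * m summable[of p] by fastforce
    qed (simp add: nonint)
  qed (simp add: summable)
  \<comment> \<open>The power from delta at \<open>m\<close> and that from the dilation at
    \<open>m + n\<close> combine to a power in \<open>m - n\<close>. The bare delta lives on
    \<open>n = - m\<close>, where 2m = m - n.\<close>
  have C: "?C m n = ?R m n" if "m \<in> ZZ A" "n \<in> ZZ A" for m n
  proof -
    have "qpow h (4*(k+1) * of_real m) * qpow h (- (2*(k+1)) * of_real (m + n)) = qpow h ((2*k+2) * of_real (m - n))"
      "qpow h (2*(k+1) * of_real m) * qpow h (- (k+1) * of_real (m + n)) = qpow h ((k+1) * of_real (m - n))"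
      by (simp_all add: algebra_simps flip: qpow_add)
    moreover have "delta h scale A (2*(k+2)) m n = scale (qpow h ((k+2) * of_real (m - n)) * kdelta (m + n)) 1"
      using that by (auto simp: delta_def kdelta_def algebra_simps)
    ultimately show ?thesis
      using that by (simp add: fd_scale_def delta_in_w dil_def)
  qed
  \<comment> \<open>If only \<open>m\<close> lies in \<open>ZZ A\<close>, then \<open>m + n\<close>
    is not an integer and the product of the \<open>K\<close> and \<open>T\<close> vanish there; if
    \<open>m\<close> does not, every delta vanishes.\<close>
  have C_0: "?C m n = 0" if "\<not> (m \<in> ZZ A \<and> n \<in> ZZ A)" for m n
  proof (cases "m \<in> ZZ A")
    case True
    then have "m + n \<notin> \<int>" using that ZZ_add_imp by blast
    moreover from this have "delta h scale A (2*(k+2)) m n = 0" by (auto simp: delta_def)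
    ultimately show ?thesis
      by (simp add: fd_scale_def delta_in_w dil_def M_0 T_0)
  next
    case False
    then have "delta h scale A (2*(k+2)) m n = 0" by (simp add: delta_def)
    with False show ?thesis by (simp add: fd_scale_def delta_in_w)
  qed
  have "?D = ?C \<longleftrightarrow> (\<forall>m n. ?L m n = ?C m n)"
    by (simp add: fun_eq_iff in_z_in_w in_w_in_z)
  also have "\<dots> \<longleftrightarrow> (\<forall>m\<in>ZZ A. \<forall>n\<in>ZZ A. ?L m n = ?R m n)"
  proof (intro iffI allI ballI)
    fix m n
    assume *: "\<forall>m\<in>ZZ A. \<forall>n\<in>ZZ A. ?L m n = ?R m n"
    show "?L m n = ?C m n"
    proof (cases "m \<in> ZZ A \<and> n \<in> ZZ A")
      case True
      then show ?thesis using * C by presburger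
    next
      case False
      then have "?L m n = 0" using G_0 by auto
      then show ?thesis using C_0[OF False] by presburger
    qed
  next
    fix m n
    assume "\<forall>m n. ?L m n = ?C m n" "m \<in> ZZ A" "n \<in> ZZ A"
    then show "?L m n = ?R m n" using C by presburger
  qed
  finally show ?thesis
    unfolding current_9_def mode_R9_def defined infsum by blast
qed

text \<open>The outer modes can be nonzero only at integers, and integer shifts preserve
  \<open>ZZ B\<close>; hence the middle index leaves \<open>ZZ B\<close> together with
  \<open>p\<close>.\<close>

lemma K_K_nonint:
  assumes "\<And>b. b \<notin> ZZ B \<Longrightarrow> Y b = 0" "p \<notin> ZZ B"
  shows "K Minus a * Y b * K Plus (p - a - b) = 0"
proof (cases "a \<in> \<int> \<and> p - a - b \<in> \<int>")
  case True
  then have "b + (a + (p - a - b)) \<notin> ZZ B" using assms(2) by simp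
  then have "b \<notin> ZZ B" using ZZ_add_int True Ints_add by blast
  then show ?thesis using assms by simp
qed (auto simp: K_0)

lemma summable_triple_nat_iff:
  "(\<lambda>(\<alpha>, \<beta>). K Minus (- real \<alpha>) * Y (p + real \<alpha> - real \<beta>) * K Plus (real \<beta>)) summable_on UNIV
    \<longleftrightarrow> (\<lambda>(a, b). K Minus a * Y b * K Plus (p - a - b)) summable_on UNIV"
  by (rule has_sum_eq_imp_summable_on_eq) (rule has_sum_triple_nat_iff[where X = "K Minus" and Z = "K Plus", OF K_Minus_0 K_Plus_0])

lemma infsum_triple_nat:
  "(\<Sum>\<^sub>\<infinity>(\<alpha>, \<beta>)\<in>UNIV. K Minus (- real \<alpha>) * Y (p + real \<alpha> - real \<beta>) * K Plus (real \<beta>))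
    = mult3 (K Minus) Y (K Plus) p"
  unfolding mult3_def by (rule has_sum_eq_imp_infsum_eq) (rule has_sum_triple_nat_iff[where X = "K Minus" and Z = "K Plus", OF K_Minus_0 K_Plus_0])

text \<open>The indices \<open>m + n\<close> run through all of \<open>ZZ B\<close>, already with
  \<open>n = 0\<close>; at other total degrees every summand is zero.\<close>

lemma mult3_defined_iff:
  assumes "\<And>b. b \<notin> ZZ B \<Longrightarrow> Y b = 0"
  shows "mult3_defined (K Minus) Y (K Plus) \<longleftrightarrow>
    (\<forall>m\<in>ZZ B. \<forall>n::int. (\<lambda>(\<alpha>, \<beta>). K Minus (- real \<alpha>) * Y (m + of_int n + real \<alpha> - real \<beta>) * K Plus (real \<beta>))
      summable_on UNIV)"
  unfolding mult3_defined_def summable_triple_nat_iff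
proof (intro iffI allI ballI)
  fix p
  assume *: "\<forall>m\<in>ZZ B. \<forall>n::int. (\<lambda>(a, b). K Minus a * Y b * K Plus (m + of_int n - a - b)) summable_on UNIV"
  show "(\<lambda>(a, b). K Minus a * Y b * K Plus (p - a - b)) summable_on UNIV"
  proof (cases "p \<in> ZZ B")
    case True
    then show ?thesis using *[rule_format, of p 0] by simp
  next
    case False
    then show ?thesis using K_K_nonint[where Y = Y and B = B, OF assms False] by (intro summable_on_0) auto
  qed
qed auto

lemma mult3_eq_0:
  assumes "\<And>b. b \<notin> ZZ B \<Longrightarrow> Y b = 0" "p \<notin> ZZ B"
  shows "mult3 (K Minus) Y (K Plus) p = 0"
  using K_K_nonint[where Y = Y and B = B, OF assms] unfolding mult3_def by (intro infsum_0) auto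

lemma mode_R10_iff: "mode_R10 h k A scale K T G \<longleftrightarrow> current_10 h k A scale K T G"
proof -
  let ?M = "\<lambda>s. mult3 (K Minus) (G s) (K Plus)"
  let ?c = "\<lambda>s. sg s * qd h * (qnum h (k+2) / qnum h (k+1))"
  let ?L = "\<lambda>s m n. G s m * T n - T n * G s m"
  let ?D = "\<lambda>s. in_z (G s) \<star> in_w T - in_w T \<star> in_z (G s)"
  let ?C = "\<lambda>s. fd_scale scale (?c s) (delta h scale A (sg s * 3 * (k+1)) \<star>
      in_w (mult3 (dil h scale (sg s * (k+1)) (K Minus)) (dil h scale (sg s * (k+1)) (G s))
        (dil h scale (sg s * (k+1)) (K Plus))))"
  let ?R = "\<lambda>s m n. scale (?c s * qpow h (sg s * (k+1) * of_real (2*m - n))) (?M s (m + n))"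
  have C: "?C s m n = ?R s m n" if "m \<in> ZZ A" for s m n
  proof -
    have "qpow h (sg s * 3 * (k+1) * of_real m) * qpow h (- (sg s * (k+1)) * of_real (m + n))
        = qpow h (sg s * (k+1) * of_real (2*m - n))"
      by (simp add: algebra_simps flip: qpow_add)
    then show ?thesis
      using that by (simp add: fd_scale_def delta_in_w mult3_dil)
  qed
  have "?D s = ?C s \<longleftrightarrow> (\<forall>m\<in>ZZ A. \<forall>n::int. ?L s m n = ?R s m n)" for s
  proof -
    have "?D s = ?C s \<longleftrightarrow> (\<forall>m n. ?L s m n = ?C s m n)"
      by (simp add: fun_eq_iff in_z_in_w in_w_in_z)
    also have "\<dots> \<longleftrightarrow> (\<forall>m\<in>ZZ A. \<forall>n::int. ?L s m n = ?R s m n)"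
    proof (intro iffI allI ballI)
      fix m n :: real
      assume *: "\<forall>m\<in>ZZ A. \<forall>n::int. ?L s m n = ?R s m n"
      consider "m \<notin> ZZ A" | "m \<in> ZZ A" "n \<notin> \<int>" | "m \<in> ZZ A" "n \<in> \<int>" by blast
      then show "?L s m n = ?C s m n"
      proof cases
        case 1
        then show ?thesis by (simp add: G_0 fd_scale_def delta_in_w)
      next
        case 2
        \<comment> \<open>The formula \<open>C\<close> holds for every real \<open>n\<close>, so at
          noninteger \<open>n\<close> it remains to see that the triple product has no mode of
          degree \<open>m + n\<close>.\<close>
        then have "m + n \<notin> ZZ A"
          by (metis ZZ_add_imp ZZ_add_int ZZ_add Ints_minus add.commute add_minus_cancel minus_add_cancel)
        then show ?thesis using 2 C mult3_eq_0[where Y = "G s" and B = A, OF G_0] by (simp add: T_0)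
      next
        case 3
        then obtain n' where "n = of_int n'" by (auto elim: Ints_cases)
        then show ?thesis using * 3 C by metis
      qed
    next
      fix m and n :: int
      assume "\<forall>m n. ?L s m n = ?C s m n" "m \<in> ZZ A"
      then show "?L s m n = ?R s m n" using C by presburger
    qed
    finally show ?thesis .
  qed
  moreover have "mult3_defined (K Minus) (G s) (K Plus) \<longleftrightarrow>
    (\<forall>m\<in>ZZ A. \<forall>n::int. (\<lambda>(\<alpha>, \<beta>). K Minus (- real \<alpha>) * G s (m + of_int n + real \<alpha> - real \<beta>) * K Plus (real \<beta>))
      summable_on UNIV)" for s
    by (rule mult3_defined_iff) (rule G_0)
  ultimately show ?thesis
    unfolding current_10_def mode_R10_def infsum_triple_nat Let_def mult3_defined_dil by blast
qed

lemma W_0: "m \<notin> ZZ R \<Longrightarrow> W h k A scale K T G m = 0"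
  by (simp add: W_def)

text \<open>Both delta terms carry the same mode of the triple product with \<open>W\<close>, with
  opposite powers of q. Their difference is \<open>qd h\<close> times [(m-n)(k+1)], which accounts
  for the square of \<open>qd h\<close> in the mode relation.\<close>

lemma mode_R11_iff:
  assumes "qd h \<noteq> 0"
  shows "mode_R11 h k A scale K T G \<longleftrightarrow> current_11 h k A scale K T G"
proof -
  let ?W = "W h k A scale K T G"
  let ?M = "mult3 (K Minus) ?W (K Plus)"
  let ?c = "qd h * ((qnum h (k+2))\<^sup>2 / qnum h (k+1))"
  let ?L = "\<lambda>m n. T m * T n - T n * T m"
  let ?D = "in_z T \<star> in_w T - in_w T \<star> in_z T"
  let ?E = "\<lambda>u. mult3 (dil h scale u (K Minus)) (dil h scale u ?W) (dil h scale u (K Plus))"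
  let ?C = "fd_scale scale ?c (delta h scale R (2*(k+1)) \<star> in_w (?E (k + 1))
      - delta h scale R (-2*(k+1)) \<star> in_w (?E (- k - 1)))"
  let ?R = "\<lambda>m n. scale ((qd h)\<^sup>2 * ((qnum h (k+2))\<^sup>2 / qnum h (k+1))
      * qnum h ((of_real m - of_real n) * (k+1))) (?M (m + n))"
  have C: "?C m n = ?R m n" if "m \<in> \<int>" for m n
  proof -
    have "qpow h (2*(k+1) * of_real m) * qpow h (- (k+1) * of_real (m + n)) = qpow h ((of_real m - of_real n) * (k+1))"
      "qpow h (-2*(k+1) * of_real m) * qpow h (- (- k - 1) * of_real (m + n)) = qpow h (- ((of_real m - of_real n) * (k+1)))"
      by (simp_all add: algebra_simps flip: qpow_add)
    then have "?C m n = scale ?c (scale (qpow h ((of_real m - of_real n) * (k+1))) (?M (m + n))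
        - scale (qpow h (- ((of_real m - of_real n) * (k+1)))) (?M (m + n)))"
      using that by (simp add: fd_scale_def delta_in_w mult3_dil)
    also have "\<dots> = ?R m n"
      using assms by (simp add: qnum_def qd_def power2_eq_square flip: scale_left_diff_distrib)
    finally show ?thesis .
  qed
  have "?D = ?C \<longleftrightarrow> (\<forall>m n. ?L m n = ?C m n)"
    by (simp add: fun_eq_iff in_z_in_w in_w_in_z)
  also have "\<dots> \<longleftrightarrow> (\<forall>(m::int) (n::int). ?L m n = ?R m n)"
  proof (intro iffI allI)
    fix m n :: real
    assume *: "\<forall>(m::int) (n::int). ?L m n = ?R m n"
    consider "m \<notin> \<int>" | "m \<in> \<int>" "n \<notin> \<int>" | "m \<in> \<int>" "n \<in> \<int>" by blast
    then show "?L m n = ?C m n"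
    proof cases
      case 1
      then show ?thesis by (simp add: T_0 fd_scale_def delta_in_w)
    next
      case 2
      then have "m + n \<notin> ZZ R" using ZZ_add_imp[of m R n] by auto
      then show ?thesis using 2 C mult3_eq_0[where Y = ?W and B = R, OF W_0] by (simp add: T_0)
    next
      case 3
      then obtain m' n' where "m = of_int m'" "n = of_int n'" by (auto elim!: Ints_cases)
      then show ?thesis using * C[OF 3(1)] by metis
    qed
  next
    fix m n :: int
    assume "\<forall>m n. ?L m n = ?C m n"
    then show "?L m n = ?R m n" using C[of m n] by simp
  qed
  finally have "?D = ?C \<longleftrightarrow> (\<forall>(m::int) (n::int). ?L m n = ?R m n)" .
  moreover have "mult3_defined (K Minus) ?W (K Plus) \<longleftrightarrow>
    (\<forall>(m::int) (n::int). (\<lambda>(\<alpha>, \<beta>). K Minus (- real \<alpha>) * ?W (of_int (m + n) + real \<alpha> - real \<beta>) * K Plus (real \<beta>))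
      summable_on UNIV)"
    using mult3_defined_iff[where Y = ?W and B = R, OF W_0] by (auto elim!: Ints_cases)
  ultimately show ?thesis
    unfolding current_11_def mode_R11_def infsum_triple_nat Let_def mult3_defined_dil by auto
qed

end

end

theorem proposition2p2:
  fixes q h k :: complex
    and A :: sector
    and scale :: "complex \<Rightarrow> 'a \<Rightarrow> 'a::{ring_1, topological_ab_group_add, t2_space}"
    and K :: "sign \<Rightarrow> real \<Rightarrow> 'a"
    and T :: "real \<Rightarrow> 'a"
    and G :: "sign \<Rightarrow> real \<Rightarrow> 'a"
  assumes "generic_parameters q h k"
    and "complex_algebra scale"
    and "mode_families A K T G"
  shows "(mode_R2 K \<longleftrightarrow> current_2 K)
    \<and> (mode_R3 h k scale K \<longleftrightarrow> current_3 h k scale K)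
    \<and> (mode_R4 h k scale K T \<longleftrightarrow> current_4 h k scale K T)
    \<and> (mode_R5 h k scale K T \<longleftrightarrow> current_5 h k scale K T)
    \<and> (mode_R6 h k A scale K G \<longleftrightarrow> current_6 h k scale K G)
    \<and> (mode_R7 h k A scale K G \<longleftrightarrow> current_7 h k scale K G)
    \<and> (mode_R8 A G \<longleftrightarrow> current_8 G)
    \<and> (mode_R9 h k A scale K T G \<longleftrightarrow> current_9 h k A scale K T G)
    \<and> (mode_R10 h k A scale K T G \<longleftrightarrow> current_10 h k A scale K T G)
    \<and> (mode_R11 h k A scale K T G \<longleftrightarrow> current_11 h k A scale K T G)"
proof -
  interpret complex_algebra scale by fact
  note families = assms(3)
  have q: "q = qpow h 1" "\<And>n::nat. n > 0 \<Longrightarrow> q ^ n \<noteq> 1"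
    using assms(1) by (auto simp: generic_parameters_def qpow_def)
  \<comment> \<open>An equality would make q a root of unity of order dividing 2j. The case
    \<open>j = 1\<close> gives \<open>qd h \<noteq> 0\<close>; \<open>j = 2\<close> separates the
    poles for \<open>mode_R3_iff\<close>.\<close>
  have ne: "qpow h (of_nat j) \<noteq> qpow h (- of_nat j)" if "j > 0" for j :: nat
  proof
    assume "qpow h (of_nat j) = qpow h (- of_nat j)"
    then have "q ^ (j + j) = qpow h (of_nat j) * qpow h (- of_nat j)"
      by (simp add: q(1) qpow_power power_add)
    also have "\<dots> = 1" by (simp flip: qpow_add)
    finally show False using q(2)[of "j + j"] that by simp
  qed
  have qd: "qd h \<noteq> 0" using ne[of 1] by (simp add: qd_def)
  have two: "qpow h 2 \<noteq> qpow h (- 2)" using ne[of 2] by simp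
  have k3: "qnum h (k+3) \<noteq> 0" using assms(1) by (simp add: generic_parameters_def)
  show ?thesis
    using mode_R2_iff[OF families] mode_R3_iff[OF families qd two] mode_R4_iff[OF families qd k3]
      mode_R5_iff[OF families qd k3] mode_R6_iff[OF families qd] mode_R7_iff[OF families qd]
      mode_R8_iff[OF families] mode_R9_iff[OF families] mode_R10_iff[OF families]
      mode_R11_iff[OF families qd]
    by blast
qed

end
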